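(* Let $\omega_1,\omega_2\in\mathbb{C}$ with $\Im(\omega_1/\omega_2)>0$, let $\Lambda(\omega_1,\omega_2)=\mathbb{Z}\omega_1+\mathbb{Z}\omega_2$, and let $\mathcal{E}=\mathbb{C}/\Lambda(\omega_1,\omega_2)$ be the corresponding nonsingular complex elliptic curve, with its abelian heap $H(\mathcal{E})$. Then every endomorphism of $\mathcal{E}$ (i.e. every complex analytic map $\mathcal{E}\to\mathcal{E}$, not required to preserve any point) is an endomorphism of the heap $H(\mathcal{E})$. Consequently, the set of all endomorphisms of $\mathcal{E}$ forms a unital truss $T(\mathcal{E})$ with the ternary operation inherited from that of $H(\mathcal{E})$, that is, $$[f,g,h](A)=[f(A),g(A),h(A)],\qquad \text{for all } A\in\mathcal{E},$$ and with multiplication given by composition of maps.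
   Context: An abelian heap is a set $H$ with a ternary operation $[-,-,-]:H\times H\times H\to H$ such that for all $A,B,C,D,E\in H$: $[[A,B,C],D,E]=[A,B,[C,D,E]]$, $[A,B,B]=[B,B,A]=A$, and $[A,B,C]=[C,B,A]$. An endomorphism of a heap $H$ is a map $f:H\to H$ with $f([A,B,C])=[f(A),f(B),f(C)]$ for all $A,B,C\in H$. A truss is an abelian heap $T$ together with an associative binary multiplication (juxtaposition) which distributes over the heap operation: $a[b,c,d]=[ab,ac,ad]$ and $[a,b,c]d=[ad,bd,cd]$ for all $a,b,c,d\in T$. A truss is unital if its multiplication has a two-sided identity element. The heap $H(\mathcal{E})$: for a class $[a]\in\mathcal{E}=\mathbb{C}/\Lambda(\omega_1,\omega_2)$ of $a\in\mathbb{C}$, the ternary operation on $\mathcal{E}$ is $$[A,B,C]=[a-b+c]\qquad\text{for } A=[a],\ B=[b],\ C=[c].$$ This is an abelian heap operation. (When $\mathcal{E}$ is viewed as a plane cubic via the Weierstrass function $\wp$ and its derivative $\wp'$, this is the operation obtained as follows: let $D$ be the third point of intersection with $\mathcal{E}$ of the line through $A$ and $C$ (tangent line at $A$ if $A=C$); then $[A,B,C]$ is the third point of intersection with $\mathcal{E}$ of the line through $D$ and $B$ (tangent line at $B$ if $D=B$).) Endomorphism of the elliptic curve $\mathcal{E}$ means any complex analytic (holomorphic) map $\mathcal{E}\to\mathcal{E}$; no preservation of a distinguished point is required. *)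

theory Defs
  imports "HOL-Analysis.Analysis"
begin

section \<open>Abelian heaps and trusses\<close>

locale abelian_heap =
  fixes H :: "'a set" and br :: "'a \<Rightarrow> 'a \<Rightarrow> 'a \<Rightarrow> 'a"
  assumes br_closed: "\<lbrakk>a \<in> H; b \<in> H; c \<in> H\<rbrakk> \<Longrightarrow> br a b c \<in> H"
    and br_assoc: "\<lbrakk>a \<in> H; b \<in> H; c \<in> H; d \<in> H; e \<in> H\<rbrakk>
      \<Longrightarrow> br (br a b c) d e = br a b (br c d e)"
    and br_right_cancel: "\<lbrakk>a \<in> H; b \<in> H\<rbrakk> \<Longrightarrow> br a b b = a"
    and br_left_cancel: "\<lbrakk>a \<in> H; b \<in> H\<rbrakk> \<Longrightarrow> br b b a = a"
    and br_commute: "\<lbrakk>a \<in> H; b \<in> H; c \<in> H\<rbrakk> \<Longrightarrow> br a b c = br c b a"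

locale heap_endomorphism = abelian_heap H br
  for H :: "'a set" and br :: "'a \<Rightarrow> 'a \<Rightarrow> 'a \<Rightarrow> 'a" +
  fixes f :: "'a \<Rightarrow> 'a"
  assumes endo_closed: "a \<in> H \<Longrightarrow> f a \<in> H"
    and endo_br: "\<lbrakk>a \<in> H; b \<in> H; c \<in> H\<rbrakk> \<Longrightarrow> f (br a b c) = br (f a) (f b) (f c)"

locale truss = abelian_heap T br
  for T :: "'a set" and br :: "'a \<Rightarrow> 'a \<Rightarrow> 'a \<Rightarrow> 'a" +
  fixes mul :: "'a \<Rightarrow> 'a \<Rightarrow> 'a"
  assumes mul_closed: "\<lbrakk>a \<in> T; b \<in> T\<rbrakk> \<Longrightarrow> mul a b \<in> T"
    and mul_assoc: "\<lbrakk>a \<in> T; b \<in> T; c \<in> T\<rbrakk> \<Longrightarrow> mul (mul a b) c = mul a (mul b c)"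
    and distrib_left: "\<lbrakk>a \<in> T; b \<in> T; c \<in> T; d \<in> T\<rbrakk>
      \<Longrightarrow> mul a (br b c d) = br (mul a b) (mul a c) (mul a d)"
    and distrib_right: "\<lbrakk>a \<in> T; b \<in> T; c \<in> T; d \<in> T\<rbrakk>
      \<Longrightarrow> mul (br a b c) d = br (mul a d) (mul b d) (mul c d)"

locale unital_truss = truss +
  assumes ex_identity: "\<exists>u\<in>T. \<forall>a\<in>T. mul u a = a \<and> mul a u = a"


section \<open>Holomorphic maps between spaces with complex atlases\<close>

text \<open>An atlas is given as a set of pairs \<open>(U, \<phi>)\<close> of an open domain and a chart on it with
  values in the complex numbers. A map is holomorphic if it is continuous and all its local
  expressions \<open>\<psi> \<circ> f \<circ> \<phi>\<inverse>\<close> are holomorphic where they are defined.\<close>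

definition holomorphic_map ::
    "'a topology \<Rightarrow> ('a set \<times> ('a \<Rightarrow> complex)) set
      \<Rightarrow> 'b topology \<Rightarrow> ('b set \<times> ('b \<Rightarrow> complex)) set \<Rightarrow> ('a \<Rightarrow> 'b) \<Rightarrow> bool" where
  "holomorphic_map X \<A> Y \<B> f \<longleftrightarrow>
     continuous_map X Y f \<and>
     (\<forall>(U, \<phi>)\<in>\<A>. \<forall>(V, \<psi>)\<in>\<B>.
        (\<psi> \<circ> f \<circ> inv_into U \<phi>) holomorphic_on \<phi> ` {p \<in> U. f p \<in> V})"


section \<open>The elliptic curve of a lattice\<close>

definition period_lattice :: "complex \<Rightarrow> complex \<Rightarrow> complex set" where
  "period_lattice \<omega>\<^sub>1 \<omega>\<^sub>2 = {of_int m * \<omega>\<^sub>1 + of_int n * \<omega>\<^sub>2 | m n. True}"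

definition torus_rel :: "complex \<Rightarrow> complex \<Rightarrow> (complex \<times> complex) set" where
  "torus_rel \<omega>\<^sub>1 \<omega>\<^sub>2 = {(z, w). z - w \<in> period_lattice \<omega>\<^sub>1 \<omega>\<^sub>2}"

lemma equiv_torus_rel: "equiv UNIV (torus_rel \<omega>\<^sub>1 \<omega>\<^sub>2)"
proof (rule equivI)
  show "refl (torus_rel \<omega>\<^sub>1 \<omega>\<^sub>2)"
    unfolding refl_on_def torus_rel_def period_lattice_def
    by (auto intro!: exI[of _ "0::int"])
  show "sym (torus_rel \<omega>\<^sub>1 \<omega>\<^sub>2)"
  proof (rule symI)
    fix x y assume "(x, y) \<in> torus_rel \<omega>\<^sub>1 \<omega>\<^sub>2"
    then obtain m n where "x - y = of_int m * \<omega>\<^sub>1 + of_int n * \<omega>\<^sub>2"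
      by (auto simp: torus_rel_def period_lattice_def)
    then have "y - x = of_int (-m) * \<omega>\<^sub>1 + of_int (-n) * \<omega>\<^sub>2"
      by (simp add: algebra_simps)
    then show "(y, x) \<in> torus_rel \<omega>\<^sub>1 \<omega>\<^sub>2"
      unfolding torus_rel_def period_lattice_def by blast
  qed
  show "trans (torus_rel \<omega>\<^sub>1 \<omega>\<^sub>2)"
  proof (rule transI)
    fix x y z assume "(x, y) \<in> torus_rel \<omega>\<^sub>1 \<omega>\<^sub>2" "(y, z) \<in> torus_rel \<omega>\<^sub>1 \<omega>\<^sub>2"
    then obtain m n m' n' where "x - y = of_int m * \<omega>\<^sub>1 + of_int n * \<omega>\<^sub>2"
      "y - z = of_int m' * \<omega>\<^sub>1 + of_int n' * \<omega>\<^sub>2"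
      by (auto simp: torus_rel_def period_lattice_def)
    then have "x - z = of_int (m + m') * \<omega>\<^sub>1 + of_int (n + n') * \<omega>\<^sub>2"
      by (simp add: algebra_simps)
    then show "(x, z) \<in> torus_rel \<omega>\<^sub>1 \<omega>\<^sub>2"
      unfolding torus_rel_def period_lattice_def by blast
  qed
qed auto

definition elliptic_curve :: "complex \<Rightarrow> complex \<Rightarrow> complex set set" where
  "elliptic_curve \<omega>\<^sub>1 \<omega>\<^sub>2 = UNIV // torus_rel \<omega>\<^sub>1 \<omega>\<^sub>2"

definition torus_class :: "complex \<Rightarrow> complex \<Rightarrow> complex \<Rightarrow> complex set" where
  "torus_class \<omega>\<^sub>1 \<omega>\<^sub>2 a = torus_rel \<omega>\<^sub>1 \<omega>\<^sub>2 `` {a}"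

lemma elliptic_curve_eq_range: "elliptic_curve \<omega>\<^sub>1 \<omega>\<^sub>2 = range (torus_class \<omega>\<^sub>1 \<omega>\<^sub>2)"
  by (auto simp: elliptic_curve_def torus_class_def quotient_def)

lemma torus_class_eq_iff:
  "torus_class \<omega>\<^sub>1 \<omega>\<^sub>2 a = torus_class \<omega>\<^sub>1 \<omega>\<^sub>2 b \<longleftrightarrow> a - b \<in> period_lattice \<omega>\<^sub>1 \<omega>\<^sub>2"
  using eq_equiv_class_iff[OF equiv_torus_rel, of a b]
  by (simp add: torus_class_def torus_rel_def)


subsection \<open>The heap operation\<close>

text \<open>The union ranges over all representatives; it is a singleton because the class of
  \<open>a - b + c\<close> does not depend on their choice.\<close>

definition elliptic_br ::
    "complex \<Rightarrow> complex \<Rightarrow> complex set \<Rightarrow> complex set \<Rightarrow> complex set \<Rightarrow> complex set" where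
  "elliptic_br \<omega>\<^sub>1 \<omega>\<^sub>2 A B C =
     the_elem (\<Union>a\<in>A. \<Union>b\<in>B. \<Union>c\<in>C. {torus_class \<omega>\<^sub>1 \<omega>\<^sub>2 (a - b + c)})"

lemma elliptic_br_class:
  "elliptic_br \<omega>\<^sub>1 \<omega>\<^sub>2 (torus_class \<omega>\<^sub>1 \<omega>\<^sub>2 a) (torus_class \<omega>\<^sub>1 \<omega>\<^sub>2 b) (torus_class \<omega>\<^sub>1 \<omega>\<^sub>2 c)
     = torus_class \<omega>\<^sub>1 \<omega>\<^sub>2 (a - b + c)"
proof -
  let ?L = "torus_class \<omega>\<^sub>1 \<omega>\<^sub>2"
  have self: "x \<in> ?L x" for x
    using equiv_class_self[OF equiv_torus_rel] by (simp add: torus_class_def)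
  have "?L (a' - b' + c') = ?L (a - b + c)"
    if mem: "a' \<in> ?L a" "b' \<in> ?L b" "c' \<in> ?L c" for a' b' c'
  proof -
    from mem obtain m n m' n' m'' n'' where
      "a - a' = of_int m * \<omega>\<^sub>1 + of_int n * \<omega>\<^sub>2"
      "b - b' = of_int m' * \<omega>\<^sub>1 + of_int n' * \<omega>\<^sub>2"
      "c - c' = of_int m'' * \<omega>\<^sub>1 + of_int n'' * \<omega>\<^sub>2"
      unfolding torus_class_def torus_rel_def period_lattice_def by blast
    moreover have "(a' - b' + c') - (a - b + c) = (b - b') - (a - a') - (c - c')"
      by simp
    ultimately have "(a' - b' + c') - (a - b + c)
        = of_int (m' - m - m'') * \<omega>\<^sub>1 + of_int (n' - n - n'') * \<omega>\<^sub>2"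
      by (simp add: left_diff_distrib)
    then show ?thesis
      unfolding torus_class_eq_iff period_lattice_def by blast
  qed
  then have "(\<Union>a'\<in>?L a. \<Union>b'\<in>?L b. \<Union>c'\<in>?L c. {?L (a' - b' + c')})
      = (\<Union>a'\<in>?L a. \<Union>b'\<in>?L b. \<Union>c'\<in>?L c. {?L (a - b + c)})"
    by (intro SUP_cong refl) auto
  moreover have "?L x \<noteq> {}" for x
    using self by auto
  ultimately have "(\<Union>a'\<in>?L a. \<Union>b'\<in>?L b. \<Union>c'\<in>?L c. {?L (a' - b' + c')}) = {?L (a - b + c)}"
    by simp
  then show ?thesis
    by (simp add: elliptic_br_def)
qed

lemma abelian_heap_elliptic:
  "abelian_heap (elliptic_curve \<omega>\<^sub>1 \<omega>\<^sub>2) (elliptic_br \<omega>\<^sub>1 \<omega>\<^sub>2)"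
proof -
  have ex_rep: "\<exists>a. A = torus_class \<omega>\<^sub>1 \<omega>\<^sub>2 a" if "A \<in> elliptic_curve \<omega>\<^sub>1 \<omega>\<^sub>2" for A
    using that by (auto simp: elliptic_curve_eq_range)
  show ?thesis
  proof (unfold_locales, goal_cases)
    case (1 A B C)
    then show ?case
      by (auto simp: elliptic_curve_eq_range elliptic_br_class)
  next
    case (2 A B C D E)
    then obtain a b c d e where "A = torus_class \<omega>\<^sub>1 \<omega>\<^sub>2 a" "B = torus_class \<omega>\<^sub>1 \<omega>\<^sub>2 b"
      "C = torus_class \<omega>\<^sub>1 \<omega>\<^sub>2 c" "D = torus_class \<omega>\<^sub>1 \<omega>\<^sub>2 d" "E = torus_class \<omega>\<^sub>1 \<omega>\<^sub>2 e"
      using ex_rep by metis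
    moreover have "(a - b + c) - d + e = a - b + (c - d + e)"
      by simp
    ultimately show ?case
      by (simp only: elliptic_br_class)
  next
    case (3 A B)
    then show ?case
      by (auto simp: elliptic_curve_eq_range elliptic_br_class)
  next
    case (4 A B)
    then show ?case
      by (auto simp: elliptic_curve_eq_range elliptic_br_class)
  next
    case (5 A B C)
    then obtain a b c where "A = torus_class \<omega>\<^sub>1 \<omega>\<^sub>2 a" "B = torus_class \<omega>\<^sub>1 \<omega>\<^sub>2 b"
      "C = torus_class \<omega>\<^sub>1 \<omega>\<^sub>2 c"
      using ex_rep by metis
    moreover have "a - b + c = c - b + a"
      by simp
    ultimately show ?case
      by (simp only: elliptic_br_class)
  qed
qed


subsection \<open>The complex structure\<close>

definition elliptic_topology :: "complex \<Rightarrow> complex \<Rightarrow> complex set topology" where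
  "elliptic_topology \<omega>\<^sub>1 \<omega>\<^sub>2 =
     topology (\<lambda>S. S \<subseteq> elliptic_curve \<omega>\<^sub>1 \<omega>\<^sub>2 \<and> open (torus_class \<omega>\<^sub>1 \<omega>\<^sub>2 -` S))"

lemma openin_elliptic_topology:
  "openin (elliptic_topology \<omega>\<^sub>1 \<omega>\<^sub>2) S \<longleftrightarrow>
     S \<subseteq> elliptic_curve \<omega>\<^sub>1 \<omega>\<^sub>2 \<and> open (torus_class \<omega>\<^sub>1 \<omega>\<^sub>2 -` S)"
proof -
  have "istopology (\<lambda>S. S \<subseteq> elliptic_curve \<omega>\<^sub>1 \<omega>\<^sub>2 \<and> open (torus_class \<omega>\<^sub>1 \<omega>\<^sub>2 -` S))"
    unfolding istopology_def by (auto simp: vimage_Union)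
  then show ?thesis
    by (simp add: elliptic_topology_def)
qed

lemma topspace_elliptic_topology:
  "topspace (elliptic_topology \<omega>\<^sub>1 \<omega>\<^sub>2) = elliptic_curve \<omega>\<^sub>1 \<omega>\<^sub>2"
proof
  have "torus_class \<omega>\<^sub>1 \<omega>\<^sub>2 -` elliptic_curve \<omega>\<^sub>1 \<omega>\<^sub>2 = UNIV"
    by (auto simp: elliptic_curve_eq_range)
  then have "openin (elliptic_topology \<omega>\<^sub>1 \<omega>\<^sub>2) (elliptic_curve \<omega>\<^sub>1 \<omega>\<^sub>2)"
    by (simp add: openin_elliptic_topology)
  then show "elliptic_curve \<omega>\<^sub>1 \<omega>\<^sub>2 \<subseteq> topspace (elliptic_topology \<omega>\<^sub>1 \<omega>\<^sub>2)"
    by (rule openin_subset)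
  show "topspace (elliptic_topology \<omega>\<^sub>1 \<omega>\<^sub>2) \<subseteq> elliptic_curve \<omega>\<^sub>1 \<omega>\<^sub>2"
    using openin_topspace[of "elliptic_topology \<omega>\<^sub>1 \<omega>\<^sub>2"]
    unfolding openin_elliptic_topology by (rule conjunct1)
qed

lemma quotient_map_torus_class:
  "quotient_map euclidean (elliptic_topology \<omega>\<^sub>1 \<omega>\<^sub>2) (torus_class \<omega>\<^sub>1 \<omega>\<^sub>2)"
  unfolding quotient_map_def topspace_elliptic_topology
  by (simp add: elliptic_curve_eq_range openin_elliptic_topology vimage_def)

text \<open>The charts are the local inverses of the projection, one for every open set on which it
  is injective.\<close>

definition elliptic_atlas ::
    "complex \<Rightarrow> complex \<Rightarrow> (complex set set \<times> (complex set \<Rightarrow> complex)) set" where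
  "elliptic_atlas \<omega>\<^sub>1 \<omega>\<^sub>2 =
     {(torus_class \<omega>\<^sub>1 \<omega>\<^sub>2 ` W, inv_into W (torus_class \<omega>\<^sub>1 \<omega>\<^sub>2)) | W.
        open W \<and> inj_on (torus_class \<omega>\<^sub>1 \<omega>\<^sub>2) W}"

text \<open>Endomorphisms are taken as extensional functions, so that equality of elements is
  equality of maps on the curve.\<close>

definition elliptic_endos :: "complex \<Rightarrow> complex \<Rightarrow> (complex set \<Rightarrow> complex set) set" where
  "elliptic_endos \<omega>\<^sub>1 \<omega>\<^sub>2 =
     {f \<in> elliptic_curve \<omega>\<^sub>1 \<omega>\<^sub>2 \<rightarrow>\<^sub>E elliptic_curve \<omega>\<^sub>1 \<omega>\<^sub>2.
        holomorphic_map (elliptic_topology \<omega>\<^sub>1 \<omega>\<^sub>2) (elliptic_atlas \<omega>\<^sub>1 \<omega>\<^sub>2)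
          (elliptic_topology \<omega>\<^sub>1 \<omega>\<^sub>2) (elliptic_atlas \<omega>\<^sub>1 \<omega>\<^sub>2) f}"

end

theory Submission
  imports Defs "HOL-Complex_Analysis.Cauchy_Integral_Formula"
begin

text \<open>A holomorphic self-map \<open>f\<close> of the torus lifts locally to holomorphic functions on the
  plane. Two local lifts at the same point differ by a lattice constant nearby, so their
  derivatives glue to an entire function. It is periodic with respect to the lattice, hence
  bounded, hence a constant \<open>a\<close> by Liouville's theorem. Therefore \<open>f [z] = [a z + b]\<close> first
  locally and then, by connectedness of the plane, globally. Such affine maps respect the heap
  operation and are closed under it and under composition. Gluing the derivatives, instead of
  the lifts themselves, avoids covering space theory.\<close>

locale period_pair =
  fixes \<omega>\<^sub>1 \<omega>\<^sub>2 :: complex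
  assumes Im_pos: "Im (\<omega>\<^sub>1 / \<omega>\<^sub>2) > 0"
begin

abbreviation "\<Lambda> \<equiv> period_lattice \<omega>\<^sub>1 \<omega>\<^sub>2"
abbreviation "cls \<equiv> torus_class \<omega>\<^sub>1 \<omega>\<^sub>2"
abbreviation "curve \<equiv> elliptic_curve \<omega>\<^sub>1 \<omega>\<^sub>2"
abbreviation "curve_top \<equiv> elliptic_topology \<omega>\<^sub>1 \<omega>\<^sub>2"
abbreviation "curve_atlas \<equiv> elliptic_atlas \<omega>\<^sub>1 \<omega>\<^sub>2"

section \<open>The period lattice: discreteness and a bounded fundamental region\<close>

lemma omega2_nonzero: "\<omega>\<^sub>2 \<noteq> 0"
  using Im_pos by auto

lemma lattice_zero: "0 \<in> \<Lambda>"
  unfolding period_lattice_def by (auto intro!: exI[of _ "0::int"])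

lemma lattice_uminus: "x \<in> \<Lambda> \<Longrightarrow> - x \<in> \<Lambda>"
  unfolding period_lattice_def
  by clarify (metis add_uminus_conv_diff minus_add_distrib mult_minus_left of_int_minus)

lemma cls_diff_lattice: "x \<in> \<Lambda> \<Longrightarrow> cls (z - x) = cls z"
  using lattice_uminus[of x] by (simp add: torus_class_eq_iff)

lemma cls_in_curve [simp]: "cls z \<in> curve"
  by (simp add: elliptic_curve_eq_range)

text \<open>After division by \<open>\<omega>\<^sub>2\<close> a lattice point reads m \<tau> + n,
  with imaginary part m Im \<tau>. A small norm therefore forces m = 0, and then n = 0.\<close>

lemma lattice_discrete:
  obtains r where "r > 0" "\<And>x. x \<in> \<Lambda> \<Longrightarrow> norm x < r \<Longrightarrow> x = 0"
proof
  define \<tau> where "\<tau> = \<omega>\<^sub>1 / \<omega>\<^sub>2"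
  have \<tau>: "Im \<tau> > 0" "\<omega>\<^sub>1 = \<tau> * \<omega>\<^sub>2"
    using Im_pos omega2_nonzero by (auto simp: \<tau>_def)
  let ?r = "norm \<omega>\<^sub>2 * min 1 (Im \<tau>)"
  show "?r > 0"
    using \<tau> omega2_nonzero by simp
  fix x assume x: "x \<in> \<Lambda>" "norm x < ?r"
  then obtain m n where mn: "x = of_int m * \<omega>\<^sub>1 + of_int n * \<omega>\<^sub>2"
    by (auto simp: period_lattice_def)
  have "x = (of_int m * \<tau> + of_int n) * \<omega>\<^sub>2"
    using mn \<tau> by (simp add: algebra_simps)
  with x omega2_nonzero have small: "norm (of_int m * \<tau> + of_int n) < min 1 (Im \<tau>)"
    by (simp add: norm_mult mult.commute)
  have "m = 0"
  proof (rule ccontr)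
    assume "m \<noteq> 0"
    then have "1 * Im \<tau> \<le> \<bar>of_int m\<bar> * Im \<tau>"
      using \<tau> by (intro mult_right_mono) auto
    also have "\<dots> = \<bar>Im (of_int m * \<tau> + of_int n)\<bar>"
      using \<tau> by (simp add: abs_mult)
    also have "\<dots> \<le> norm (of_int m * \<tau> + of_int n)"
      by (rule abs_Im_le_cmod)
    finally show False
      using small by simp
  qed
  moreover from this small have "\<bar>n\<bar> < 1"
    by (simp flip: of_int_abs)
  ultimately show "x = 0"
    using mn by simp
qed

text \<open>The two periods form a real basis of the plane, and dropping the integer parts of both
  coordinates is a lattice translation. Later this bounds a periodic function.\<close>

lemma lattice_fundamental_domain:
  obtains x where "x \<in> \<Lambda>" "norm (z - x) \<le> norm \<omega>\<^sub>1 + norm \<omega>\<^sub>2"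
proof -
  define \<tau> where "\<tau> = \<omega>\<^sub>1 / \<omega>\<^sub>2"
  have \<tau>: "Im \<tau> > 0" "\<omega>\<^sub>1 = \<tau> * \<omega>\<^sub>2"
    using Im_pos omega2_nonzero by (auto simp: \<tau>_def)
  \<comment> \<open>\<open>s\<close> and \<open>t\<close> are the real coordinates of
    \<open>z\<close> in the basis of periods: in \<open>z / \<omega>\<^sub>2\<close> = s \<tau> + t
    the imaginary part yields \<open>s\<close>, and the real part then yields
    \<open>t\<close>.\<close>
  define s where "s = Im (z / \<omega>\<^sub>2) / Im \<tau>"
  define t where "t = Re (z / \<omega>\<^sub>2) - s * Re \<tau>"
  have "z / \<omega>\<^sub>2 = of_real s * \<tau> + of_real t"
    using \<tau> by (intro complex_eqI) (simp_all add: s_def t_def)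
  then have z: "z = of_real s * \<omega>\<^sub>1 + of_real t * \<omega>\<^sub>2"
    using omega2_nonzero \<tau>(2) by (metis (no_types, lifting) distrib_right mult.assoc nonzero_divide_eq_eq)
  let ?x = "of_int \<lfloor>s\<rfloor> * \<omega>\<^sub>1 + of_int \<lfloor>t\<rfloor> * \<omega>\<^sub>2"
  have "z - ?x = of_real (frac s) * \<omega>\<^sub>1 + of_real (frac t) * \<omega>\<^sub>2"
    by (simp add: z frac_def algebra_simps)
  also have "norm \<dots> \<le> frac s * norm \<omega>\<^sub>1 + frac t * norm \<omega>\<^sub>2"
    by (rule order_trans[OF norm_triangle_ineq]) (simp add: norm_mult)
  also have "\<dots> \<le> 1 * norm \<omega>\<^sub>1 + 1 * norm \<omega>\<^sub>2"
    by (intro add_mono mult_right_mono) (simp_all add: less_imp_le[OF frac_lt_1])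
  finally have "norm (z - ?x) \<le> norm \<omega>\<^sub>1 + norm \<omega>\<^sub>2"
    by simp
  moreover have "?x \<in> \<Lambda>"
    by (auto simp: period_lattice_def)
  ultimately show thesis
    using that by blast
qed

section \<open>The projection to the curve and its charts\<close>

lemma cls_locally_injective:
  obtains r where "r > 0" "\<And>z. inj_on cls (ball z r)"
proof -
  obtain r where r: "r > 0" "\<And>x. x \<in> \<Lambda> \<Longrightarrow> norm x < r \<Longrightarrow> x = 0"
    using lattice_discrete by metis
  \<comment> \<open>The radius is halved because two points of a ball may be almost a diameter
    apart.\<close>
  have "inj_on cls (ball z (r / 2))" for z
  proof (rule inj_onI)
    fix u v assume uv: "u \<in> ball z (r / 2)" "v \<in> ball z (r / 2)" "cls u = cls v"
    have "dist u v < r"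
      by (rule dist_triangle_half_r[of z]) (use uv in auto)
    with uv r(2)[of "u - v"] show "u = v"
      by (simp add: torus_class_eq_iff dist_norm)
  qed
  with r(1) show thesis
    using that[of "r / 2"] by simp
qed

text \<open>The projection is an open map: the saturation of \<open>V\<close> is the union of its
  lattice translates.\<close>

lemma openin_cls_image:
  assumes "open V"
  shows "openin curve_top (cls ` V)"
proof -
  have "cls -` (cls ` V) = (\<Union>x\<in>\<Lambda>. (+) x ` V)"
  proof safe
    fix z v assume "cls z = cls v" "v \<in> V"
    then show "z \<in> (\<Union>x\<in>\<Lambda>. (+) x ` V)"
      by (intro UN_I[of "z - v"] image_eqI[of _ _ v]) (auto simp: torus_class_eq_iff)
  next
    fix x v assume "x \<in> \<Lambda>" "v \<in> V"
    then show "x + v \<in> cls -` (cls ` V)"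
      unfolding vimage_eq
      by (intro image_eqI[of _ _ v]) (simp_all add: torus_class_eq_iff)
  qed
  then show ?thesis
    using assms by (auto simp: openin_elliptic_topology intro!: open_UN open_translation)
qed

lemma chart_image:
  assumes "inj_on cls W"
  shows "inv_into W cls ` {p \<in> cls ` W. P p} = {z \<in> W. P (cls z)}"
proof
  show "inv_into W cls ` {p \<in> cls ` W. P p} \<subseteq> {z \<in> W. P (cls z)}"
    using assms by auto
  show "{z \<in> W. P (cls z)} \<subseteq> inv_into W cls ` {p \<in> cls ` W. P p}"
  proof
    fix z assume "z \<in> {z \<in> W. P (cls z)}"
    then show "z \<in> inv_into W cls ` {p \<in> cls ` W. P p}"
      using assms by (intro image_eqI[of _ _ "cls z"]) auto
  qed
qed

lemma chart_inverse:
  assumes "inj_on cls W" "z \<in> W"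
  shows "inv_into (cls ` W) (inv_into W cls) z = cls z"
  using inv_into_f_f[OF inj_on_inv_into[OF subset_refl], of "cls z" cls W] assms
  by (simp add: inv_into_f_f)

text \<open>Charts are local inverses of the projection, so the inverse of a source chart is
  \<open>cls\<close> itself. Holomorphy thus becomes a condition on functions of a plane
  variable.\<close>

lemma holomorphic_map_curve_iff:
  "holomorphic_map curve_top curve_atlas curve_top curve_atlas f \<longleftrightarrow>
     continuous_map curve_top curve_top f \<and>
     (\<forall>W V. open W \<longrightarrow> inj_on cls W \<longrightarrow> open V \<longrightarrow> inj_on cls V \<longrightarrow>
        (\<lambda>z. inv_into V cls (f (cls z))) holomorphic_on {z \<in> W. f (cls z) \<in> cls ` V})"
proof -
  have "(inv_into V cls \<circ> f \<circ> inv_into (cls ` W) (inv_into W cls)) holomorphic_on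
          inv_into W cls ` {p \<in> cls ` W. f p \<in> cls ` V}
      \<longleftrightarrow> (\<lambda>z. inv_into V cls (f (cls z))) holomorphic_on {z \<in> W. f (cls z) \<in> cls ` V}"
    if "inj_on cls W" for W V
    unfolding chart_image[OF that]
    by (rule holomorphic_cong) (auto simp: chart_inverse[OF that])
  moreover have "(\<forall>(U, \<phi>)\<in>curve_atlas. P U \<phi>) \<longleftrightarrow>
      (\<forall>W. open W \<longrightarrow> inj_on cls W \<longrightarrow> P (cls ` W) (inv_into W cls))" for P
    by (auto simp: elliptic_atlas_def)
  ultimately show ?thesis
    by (simp add: holomorphic_map_def)
qed

section \<open>Local lifts and their derivatives\<close>

text \<open>The value of \<open>g\<close> at \<open>z\<close> is left free among the representatives
  of \<open>f (cls z)\<close>, so only the derivative of a lift can be canonical.\<close>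

definition local_lift where
  "local_lift f g z e \<longleftrightarrow>
     e > 0 \<and> g holomorphic_on ball z e \<and> (\<forall>w\<in>ball z e. f (cls w) = cls (g w))"

text \<open>Turns facts about the derivative of a lift at its centre into facts at every point of
  the ball.\<close>

lemma local_lift_recenter:
  assumes "local_lift f g z e" "w \<in> ball z e"
  shows "local_lift f g w (e - dist z w)"
proof -
  have "ball w (e - dist z w) \<subseteq> ball z e"
  proof
    fix u assume "u \<in> ball w (e - dist z w)"
    with dist_triangle[of z u w] show "u \<in> ball z e"
      by simp
  qed
  with assms show ?thesis
    by (auto simp: local_lift_def intro: holomorphic_on_subset)
qed

text \<open>Source of the periodicity of the derivative: \<open>f (cls w)\<close> is unchanged when
  \<open>w\<close> moves by a lattice vector.\<close>

lemma local_lift_translate: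
  assumes "local_lift f g z e" "x \<in> \<Lambda>"
  shows "local_lift f (\<lambda>w. g (w - x)) (z + x) e"
proof -
  have mem: "w - x \<in> ball z e" if "w \<in> ball (z + x) e" for w
    using that by (simp add: dist_norm algebra_simps)
  have "(g \<circ> (\<lambda>w. w - x)) holomorphic_on ball (z + x) e"
    using assms(1) mem
    by (intro holomorphic_on_compose_gen[of _ _ _ "ball z e"])
       (auto simp: local_lift_def intro!: holomorphic_intros)
  moreover have "f (cls w) = cls (g (w - x))" if "w \<in> ball (z + x) e" for w
    using assms mem[OF that] cls_diff_lattice[of x w] unfolding local_lift_def by metis
  ultimately show ?thesis
    using assms(1) by (simp add: local_lift_def o_def)
qed

text \<open>The difference of two lifts is continuous with values in a discrete set, hence constant
  near \<open>z\<close>.\<close>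

lemma local_lift_deriv_unique:
  assumes "local_lift f g z e" "local_lift f g' z e'"
  shows "deriv g z = deriv g' z"
proof -
  obtain r where r: "r > 0" "\<And>x. x \<in> \<Lambda> \<Longrightarrow> norm x < r \<Longrightarrow> x = 0"
    using lattice_discrete by metis
  define x where "x = g z - g' z"
  let ?B = "ball z (min e e')"
  have e: "z \<in> ?B"
    using assms by (simp add: local_lift_def)
  have hol: "g holomorphic_on ?B" "g' holomorphic_on ?B"
    using assms by (auto simp: local_lift_def elim: holomorphic_on_subset)
  have lat: "g w - g' w \<in> \<Lambda>" if "w \<in> ?B" for w
  proof -
    have "w \<in> ball z e" "w \<in> ball z e'"
      using that by auto
    then have "cls (g w) = cls (g' w)"
      using assms unfolding local_lift_def by metis
    then show ?thesis
      by (simp add: torus_class_eq_iff)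
  qed
  have diff: "g field_differentiable at z" "g' field_differentiable at z"
    using hol e by (blast intro: holomorphic_on_imp_differentiable_at open_ball)+
  then have "isCont (\<lambda>w. g w - g' w) z"
    by (intro continuous_diff field_differentiable_imp_continuous_at)
  then have "((\<lambda>w. g w - g' w) \<longlongrightarrow> x) (nhds z)"
    unfolding x_def isCont_def
    using tendsto_at_iff_tendsto_nhds[of "\<lambda>w. g w - g' w" z] by simp
  then have "\<forall>\<^sub>F w in nhds z. dist (g w - g' w) x < r"
    using r(1) by (rule tendstoD)
  moreover have "\<forall>\<^sub>F w in nhds z. w \<in> ?B"
    using e by (intro eventually_nhds_in_open) auto
  ultimately have "\<forall>\<^sub>F w in nhds z. g w = g' w + x"
  proof eventually_elim
    case (elim w)
    \<comment> \<open>Both arguments are lattice points and so lie in the class of 0. Their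
      difference is then a lattice point of norm below \<open>r\<close>.\<close>
    have "cls (g w - g' w) = cls x"
      using lat[OF elim(2)] lat[OF e] lattice_zero
      by (metis diff_zero torus_class_eq_iff x_def)
    then have "g w - g' w - x = 0"
      using elim(1) by (intro r(2)) (auto simp: torus_class_eq_iff dist_norm)
    then show ?case
      by (simp add: algebra_simps)
  qed
  then have "deriv g z = deriv (\<lambda>w. g' w + x) z"
    by (rule deriv_cong_ev) simp
  also have "\<dots> = deriv g' z"
    using diff by simp
  finally show ?thesis .
qed

lemma endo_lift_open:
  assumes "continuous_map curve_top curve_top f" "open V"
  shows "open {z. f (cls z) \<in> cls ` V}"
proof -
  have "continuous_map euclidean curve_top (f \<circ> cls)"
    using assms(1) quotient_map_torus_class
    by (metis continuous_map_compose quotient_imp_continuous_map)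
  from openin_continuous_map_preimage[OF this openin_cls_image[OF assms(2)]]
  show ?thesis by (simp add: o_def)
qed

text \<open>The lift is \<open>f\<close> read in a chart around \<open>f (cls z)\<close>; continuity
  of \<open>f\<close> keeps nearby values inside that chart.\<close>

lemma ex_local_lift:
  assumes "f \<in> elliptic_endos \<omega>\<^sub>1 \<omega>\<^sub>2"
  shows "\<exists>g e. local_lift f g z e"
proof -
  have hol: "holomorphic_map curve_top curve_atlas curve_top curve_atlas f"
    and PiE: "f \<in> curve \<rightarrow>\<^sub>E curve"
    using assms by (auto simp: elliptic_endos_def)
  obtain r where r: "r > 0" "\<And>z. inj_on cls (ball z r)"
    using cls_locally_injective by metis
  obtain w where w: "f (cls z) = cls w"
    using PiE_mem[OF PiE, of "cls z"] by (auto simp: elliptic_curve_eq_range)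
  let ?D = "{u \<in> ball z r. f (cls u) \<in> cls ` ball w r}"
  let ?g = "\<lambda>u. inv_into (ball w r) cls (f (cls u))"
  have "?g holomorphic_on ?D"
    using hol r(2)[of z] r(2)[of w] unfolding holomorphic_map_curve_iff by blast
  moreover have "open ?D"
    using hol open_Int[OF open_ball endo_lift_open[of f "ball w r"], of z r]
    by (simp add: holomorphic_map_curve_iff Int_def)
  moreover have "z \<in> ?D"
    using w r(1) by auto
  moreover have "f (cls u) = cls (?g u)" if "u \<in> ?D" for u
    using that f_inv_into_f[of "f (cls u)" cls "ball w r"] by auto
  ultimately obtain e where "e > 0" "ball z e \<subseteq> ?D"
    using openE by blast
  with \<open>?g holomorphic_on ?D\<close> \<open>\<And>u. u \<in> ?D \<Longrightarrow> f (cls u) = cls (?g u)\<close>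
  have "local_lift f ?g z e"
    unfolding local_lift_def by (blast intro: holomorphic_on_subset)
  then show ?thesis by blast
qed

section \<open>Constancy of the derivative and the affine form of endomorphisms\<close>

lemma local_lift_deriv_constant:
  assumes "f \<in> elliptic_endos \<omega>\<^sub>1 \<omega>\<^sub>2"
  obtains a where "\<And>g z e. local_lift f g z e \<Longrightarrow> deriv g z = a"
proof -
  \<comment> \<open>The glued derivative; by \<open>local_lift_deriv_unique\<close> the lift that is
    chosen does not matter.\<close>
  define h where "h z = (SOME d. \<exists>g e. local_lift f g z e \<and> deriv g z = d)" for z
  have h: "h z = deriv g z" if "local_lift f g z e" for g z e
  proof -
    have "\<exists>g e. local_lift f g z e \<and> deriv g z = h z"
      unfolding h_def by (rule someI_ex) (use that in blast)
    then obtain g' e' where "local_lift f g' z e'" "deriv g' z = h z"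
      by blast
    then show ?thesis
      using local_lift_deriv_unique that by metis
  qed
  have h_hol: "\<exists>e>0. h holomorphic_on ball z e" for z
  proof -
    obtain g e where ge: "local_lift f g z e"
      using ex_local_lift[OF assms] by blast
    \<comment> \<open>Throughout this ball \<open>h\<close> is the derivative of the single lift
      \<open>g\<close>, by recentring, and so inherits holomorphy from it.\<close>
    have "deriv g holomorphic_on ball z e"
      using ge by (intro holomorphic_deriv) (auto simp: local_lift_def)
    then have "h holomorphic_on ball z e"
      by (rule holomorphic_transform) (rule h[OF local_lift_recenter[OF ge], symmetric])
    with ge show ?thesis
      by (auto simp: local_lift_def)
  qed
  then have entire: "h holomorphic_on UNIV"
    by (metis centre_in_ball holomorphic_on_def holomorphic_on_imp_differentiable_at open_ball
        field_differentiable_at_within)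
  have periodic: "h (z - x) = h z" if x: "x \<in> \<Lambda>" for x z
  proof -
    obtain g e where ge: "local_lift f g (z - x) e"
      using ex_local_lift[OF assms] by blast
    then have "g field_differentiable at (z - x)"
      by (auto simp: local_lift_def intro: holomorphic_on_imp_differentiable_at[of g "ball (z - x) e"])
    then have "(g has_field_derivative deriv g (z - x)) (at (z - x))"
      by (simp add: field_differentiable_derivI)
    then have "((\<lambda>w. g (w - x)) has_field_derivative deriv g (z - x)) (at z)"
      using DERIV_shift[of g "deriv g (z - x)" z "- x"] by simp
    then show ?thesis
      using h[OF ge] h[OF local_lift_translate[OF ge x]] by (simp add: DERIV_imp_deriv)
  qed
  \<comment> \<open>This compact disc meets every class modulo the lattice, so the periodic function
    \<open>h\<close> takes all its values on it.\<close>
  let ?K = "cball 0 (norm \<omega>\<^sub>1 + norm \<omega>\<^sub>2) :: complex set"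
  have "range h \<subseteq> h ` ?K"
  proof safe
    fix z
    obtain x where "x \<in> \<Lambda>" "norm (z - x) \<le> norm \<omega>\<^sub>1 + norm \<omega>\<^sub>2"
      using lattice_fundamental_domain .
    then show "h z \<in> h ` ?K"
      by (intro image_eqI[of _ _ "z - x"]) (auto simp: periodic)
  qed
  moreover have "bounded (h ` ?K)"
    using entire
    by (intro compact_imp_bounded compact_continuous_image)
       (auto intro: holomorphic_on_imp_continuous_on holomorphic_on_subset)
  ultimately have "bounded (range h)"
    by (rule bounded_subset[rotated])
  then obtain a where "h z = a" for z
    using Liouville_theorem[OF entire] by (auto simp: constant_on_def)
  with h that show thesis
    by metis
qed

text \<open>A constant derivative makes each local lift affine with the same slope \<open>a\<close>,
  but with a constant that may vary from ball to ball. Connectedness of the plane shows that one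
  constant works modulo the lattice.\<close>

lemma endo_affine:
  assumes "f \<in> elliptic_endos \<omega>\<^sub>1 \<omega>\<^sub>2"
  obtains a b where "\<And>z. f (cls z) = cls (a * z + b)"
proof -
  obtain a where a: "\<And>g z e. local_lift f g z e \<Longrightarrow> deriv g z = a"
    using local_lift_deriv_constant[OF assms] by metis
  have affine: "\<exists>c e. e > 0 \<and> (\<forall>w\<in>ball z e. f (cls w) = cls (a * w + c))" for z
  proof -
    obtain g e where ge: "local_lift f g z e"
      using ex_local_lift[OF assms] by blast
    have "((\<lambda>w. g w - a * w) has_field_derivative 0) (at w within ball z e)"
      if w: "w \<in> ball z e" for w
    proof -
      have "g field_differentiable at w"
        using ge w by (auto simp: local_lift_def intro: holomorphic_on_imp_differentiable_at)
      then have "(g has_field_derivative a) (at w)"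
        using a[OF local_lift_recenter[OF ge w]] field_differentiable_derivI by metis
      then show ?thesis
        by (auto intro!: derivative_eq_intros intro: has_field_derivative_at_within)
    qed
    then obtain c where "g w - a * w = c" if "w \<in> ball z e" for w
      using has_field_derivative_zero_constant[of "ball z e" "\<lambda>w. g w - a * w"] by auto
    then have "g w = a * w + c" if "w \<in> ball z e" for w
      using that by (metis add.commute diff_add_cancel)
    with ge show ?thesis
      unfolding local_lift_def by (intro exI[of _ c] exI[of _ e]) auto
  qed
  obtain b where b: "f (cls 0) = cls (a * 0 + b)"
    using affine[of 0] by (metis centre_in_ball)
  let ?S = "{z. f (cls z) = cls (a * z + b)}"
  \<comment> \<open>On a ball where \<open>f\<close> has constant term \<open>c\<close>, membership
    in \<open>?S\<close> says that \<open>c - b\<close> is a lattice point, whatever the point of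
    the ball. Hence \<open>?S\<close> and its complement are both open.\<close>
  have dichotomy: "\<exists>e>0. ball z e \<subseteq> ?S \<or> ball z e \<subseteq> - ?S" for z
  proof -
    obtain c e where ce: "e > 0" "\<forall>w\<in>ball z e. f (cls w) = cls (a * w + c)"
      using affine by blast
    then have "w \<in> ?S \<longleftrightarrow> c - b \<in> \<Lambda>" if "w \<in> ball z e" for w
      using that by (simp add: torus_class_eq_iff)
    with ce(1) show ?thesis
      by blast
  qed
  have "open ?S" "open (- ?S)"
    unfolding open_contains_ball
    using dichotomy by (metis (no_types, lifting) ComplD centre_in_ball subsetD)+
  then have "?S = {} \<or> ?S = UNIV"
    using clopen[of ?S] by (simp add: closed_def)
  with b that show thesis
    by blast
qed

section \<open>Affine maps as endomorphisms, and the resulting heap and truss structure\<close>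

text \<open>Converse of \<open>endo_affine\<close>, reducing closure properties to computing
  coefficients. That \<open>a\<close> maps the lattice into itself is implicit in the equation for
  \<open>f\<close>, whose left side depends only on the class of \<open>z\<close>.\<close>

lemma affine_endo:
  assumes PiE: "f \<in> curve \<rightarrow>\<^sub>E curve" and f: "\<And>z. f (cls z) = cls (a * z + b)"
  shows "f \<in> elliptic_endos \<omega>\<^sub>1 \<omega>\<^sub>2"
proof -
  have cont_F: "continuous_on UNIV (\<lambda>z. a * z + b)"
    by (intro continuous_intros)
  have "continuous_map euclidean curve_top (cls \<circ> (\<lambda>z. a * z + b))"
    using cont_F quotient_imp_continuous_map[OF quotient_map_torus_class]
    by (intro continuous_map_compose[of _ euclidean]) auto
  also have "cls \<circ> (\<lambda>z. a * z + b) = f \<circ> cls"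
    by (simp add: f o_def)
  finally have "continuous_map curve_top curve_top f"
    by (rule continuous_compose_quotient_map[OF quotient_map_torus_class])
  moreover have "(\<lambda>z. inv_into V cls (f (cls z))) holomorphic_on {z \<in> W. f (cls z) \<in> cls ` V}"
    if V: "open V" "inj_on cls V" for W V
    unfolding holomorphic_on_def
  proof
    fix z assume "z \<in> {z \<in> W. f (cls z) \<in> cls ` V}"
    then obtain v where v: "v \<in> V" "cls (a * z + b) = cls v"
      by (auto simp: f)
    \<comment> \<open>The lattice vector that carries the affine value at \<open>z\<close> into
      \<open>V\<close>. Near \<open>z\<close> the chart expression of \<open>f\<close> is the affine
      map shifted by this fixed vector.\<close>
    define x where "x = a * z + b - v"
    have x: "x \<in> \<Lambda>"
      using v by (simp add: x_def torus_class_eq_iff)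
    let ?N = "(\<lambda>w. a * w + b - x) -` V"
    have "open ?N"
      using V(1) by (intro open_vimage continuous_intros)
    have "z \<in> ?N"
      using v by (simp add: x_def)
    have eq: "a * w + b - x = inv_into V cls (f (cls w))" if "w \<in> ?N" for w
      using that V(2) cls_diff_lattice[OF x, of "a * w + b"] inv_into_f_f[of cls V "a * w + b - x"]
      by (simp add: f)
    have "(\<lambda>w. a * w + b - x) holomorphic_on ?N"
      by (intro holomorphic_intros)
    then have "(\<lambda>w. inv_into V cls (f (cls w))) holomorphic_on ?N"
      by (rule holomorphic_transform) (rule eq)
    then have "(\<lambda>w. inv_into V cls (f (cls w))) field_differentiable at z"
      using \<open>open ?N\<close> \<open>z \<in> ?N\<close> by (rule holomorphic_on_imp_differentiable_at)
    then show "(\<lambda>z. inv_into V cls (f (cls z))) field_differentiable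
        (at z within {z \<in> W. f (cls z) \<in> cls ` V})"
      by (rule field_differentiable_at_within)
  qed
  ultimately show ?thesis
    using PiE by (auto simp: elliptic_endos_def holomorphic_map_curve_iff)
qed

text \<open>Affine maps respect a - b + c because its coefficients 1, -1, 1 sum to 1, so the
  constant term survives exactly once.\<close>

lemma endo_heap_endomorphism:
  assumes "f \<in> elliptic_endos \<omega>\<^sub>1 \<omega>\<^sub>2"
  shows "heap_endomorphism curve (elliptic_br \<omega>\<^sub>1 \<omega>\<^sub>2) f"
proof -
  obtain a b where f: "\<And>z. f (cls z) = cls (a * z + b)"
    using endo_affine[OF assms] by metis
  interpret abelian_heap curve "elliptic_br \<omega>\<^sub>1 \<omega>\<^sub>2"
    by (rule abelian_heap_elliptic)
  show ?thesis
  proof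
    show "f A \<in> curve" if "A \<in> curve" for A
      using that by (auto simp: elliptic_curve_eq_range f)
    show "f (elliptic_br \<omega>\<^sub>1 \<omega>\<^sub>2 A B C) = elliptic_br \<omega>\<^sub>1 \<omega>\<^sub>2 (f A) (f B) (f C)"
      if "A \<in> curve" "B \<in> curve" "C \<in> curve" for A B C
      using that by (auto simp: elliptic_curve_eq_range f elliptic_br_class algebra_simps)
  qed
qed

text \<open>Slopes and constant terms are combined by the same alternating sum as the
  values.\<close>

lemma endo_br_closed:
  assumes "f \<in> elliptic_endos \<omega>\<^sub>1 \<omega>\<^sub>2" "g \<in> elliptic_endos \<omega>\<^sub>1 \<omega>\<^sub>2" "h \<in> elliptic_endos \<omega>\<^sub>1 \<omega>\<^sub>2"
  shows "(\<lambda>A\<in>curve. elliptic_br \<omega>\<^sub>1 \<omega>\<^sub>2 (f A) (g A) (h A)) \<in> elliptic_endos \<omega>\<^sub>1 \<omega>\<^sub>2"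
proof -
  obtain a b a' b' a'' b'' where
    eqs: "\<And>z. f (cls z) = cls (a * z + b)" "\<And>z. g (cls z) = cls (a' * z + b')"
      "\<And>z. h (cls z) = cls (a'' * z + b'')"
    using endo_affine[OF assms(1)] endo_affine[OF assms(2)] endo_affine[OF assms(3)] by metis
  show ?thesis
  proof (rule affine_endo[where a = "a - a' + a''" and b = "b - b' + b''"])
    show "(\<lambda>A\<in>curve. elliptic_br \<omega>\<^sub>1 \<omega>\<^sub>2 (f A) (g A) (h A)) \<in> curve \<rightarrow>\<^sub>E curve"
      by (auto simp: elliptic_curve_eq_range eqs elliptic_br_class)
  qed (simp add: eqs elliptic_br_class algebra_simps)
qed

lemma endo_compose_closed:
  assumes "f \<in> elliptic_endos \<omega>\<^sub>1 \<omega>\<^sub>2" "g \<in> elliptic_endos \<omega>\<^sub>1 \<omega>\<^sub>2"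
  shows "compose curve f g \<in> elliptic_endos \<omega>\<^sub>1 \<omega>\<^sub>2"
proof -
  obtain a b a' b' where
    eqs: "\<And>z. f (cls z) = cls (a * z + b)" "\<And>z. g (cls z) = cls (a' * z + b')"
    using endo_affine[OF assms(1)] endo_affine[OF assms(2)] by metis
  show ?thesis
  proof (rule affine_endo[where a = "a * a'" and b = "a * b' + b"])
    show "compose curve f g \<in> curve \<rightarrow>\<^sub>E curve"
      by (auto simp: compose_def elliptic_curve_eq_range eqs)
  qed (simp add: compose_def eqs algebra_simps)
qed

lemma endo_id: "(\<lambda>A\<in>curve. A) \<in> elliptic_endos \<omega>\<^sub>1 \<omega>\<^sub>2"
  by (rule affine_endo[where a = 1 and b = 0]) auto

text \<open>Most laws hold pointwise on the curve. Left distributivity is where the endomorphisms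
  must respect the heap operation; the cancellation and identity laws also use that elements are
  \<open>undefined\<close> off the curve.\<close>

lemma endos_unital_truss:
  "unital_truss (elliptic_endos \<omega>\<^sub>1 \<omega>\<^sub>2)
     (\<lambda>f g h. \<lambda>A\<in>curve. elliptic_br \<omega>\<^sub>1 \<omega>\<^sub>2 (f A) (g A) (h A)) (compose curve)"
proof -
  interpret E: abelian_heap curve "elliptic_br \<omega>\<^sub>1 \<omega>\<^sub>2"
    by (rule abelian_heap_elliptic)
  have mem: "f A \<in> curve" if "f \<in> elliptic_endos \<omega>\<^sub>1 \<omega>\<^sub>2" "A \<in> curve" for f A
    using that by (auto simp: elliptic_endos_def)
  have undef: "f A = undefined" if "f \<in> elliptic_endos \<omega>\<^sub>1 \<omega>\<^sub>2" "A \<notin> curve" for f A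
    using that by (auto simp: elliptic_endos_def)
  have hom: "f (elliptic_br \<omega>\<^sub>1 \<omega>\<^sub>2 A B C) = elliptic_br \<omega>\<^sub>1 \<omega>\<^sub>2 (f A) (f B) (f C)"
    if "f \<in> elliptic_endos \<omega>\<^sub>1 \<omega>\<^sub>2" "A \<in> curve" "B \<in> curve" "C \<in> curve" for f A B C
    using heap_endomorphism.endo_br[OF endo_heap_endomorphism[OF that(1)] that(2-4)] .
  show ?thesis
  proof (unfold_locales, goal_cases)
    case 1 then show ?case by (rule endo_br_closed)
  next
    case 2 then show ?case by (intro ext) (simp add: restrict_def mem E.br_assoc)
  next
    case 3 then show ?case by (intro ext) (simp add: restrict_def mem undef E.br_right_cancel)
  next
    case 4 then show ?case by (intro ext) (simp add: restrict_def mem undef E.br_left_cancel)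
  next
    case 5 then show ?case by (intro ext) (simp add: restrict_def mem E.br_commute)
  next
    case 6 then show ?case by (rule endo_compose_closed)
  next
    case 7 then show ?case by (intro ext) (simp add: compose_def restrict_def mem)
  next
    case 8 then show ?case by (intro ext) (simp add: compose_def restrict_def mem hom)
  next
    case 9 then show ?case by (intro ext) (simp add: compose_def restrict_def mem)
  next
    case 10
    show ?case
    proof (intro bexI[OF _ endo_id] ballI conjI ext)
      fix f A assume "f \<in> elliptic_endos \<omega>\<^sub>1 \<omega>\<^sub>2"
      then show "compose curve (\<lambda>A\<in>curve. A) f A = f A" "compose curve f (\<lambda>A\<in>curve. A) A = f A"
        by (simp_all add: compose_def restrict_def mem undef)
    qed
  qed
qed

end

theorem theorem2p2:
  fixes \<omega>\<^sub>1 \<omega>\<^sub>2 :: complex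
  assumes "Im (\<omega>\<^sub>1 / \<omega>\<^sub>2) > 0"
  shows "(\<forall>f \<in> elliptic_endos \<omega>\<^sub>1 \<omega>\<^sub>2.
            heap_endomorphism (elliptic_curve \<omega>\<^sub>1 \<omega>\<^sub>2) (elliptic_br \<omega>\<^sub>1 \<omega>\<^sub>2) f) \<and>
         unital_truss (elliptic_endos \<omega>\<^sub>1 \<omega>\<^sub>2)
           (\<lambda>f g h. \<lambda>A\<in>elliptic_curve \<omega>\<^sub>1 \<omega>\<^sub>2. elliptic_br \<omega>\<^sub>1 \<omega>\<^sub>2 (f A) (g A) (h A))
           (compose (elliptic_curve \<omega>\<^sub>1 \<omega>\<^sub>2))"
proof -
  interpret period_pair \<omega>\<^sub>1 \<omega>\<^sub>2
    by unfold_locales (rule assms)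
  show ?thesis
    using endo_heap_endomorphism endos_unital_truss by blast
qed

end
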